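(* Let $X$ be a Urysohn space. Then $|X|\le aL(X)^{\overline{\Delta}(X)}$.
   Context: A topological space $X$ is Urysohn if every two distinct points of $X$ have disjoint closed neighborhoods. Write $\Delta_X=\{(x,x)\in X^2:x\in X\}$. For an infinite cardinal $\kappa$, $X$ has a regular $G_\kappa$-diagonal if there is a family $(U_\eta:\eta<\kappa)$ of open sets in $X^2$ such that $\Delta_X=\bigcap_{\eta<\kappa}U_\eta=\bigcap_{\eta<\kappa}\overline{U_\eta}$. For a Urysohn space $X$, the regular diagonal degree $\overline{\Delta}(X)$ is the minimal infinite cardinal $\kappa$ such that $X$ has a regular $G_\kappa$-diagonal. The almost Lindelöf number $aL(X)$ is the smallest infinite cardinal $\kappa$ such that for every open cover $\mathcal{U}$ of $X$ there is a subcollection $\mathcal{U}_0\subset\mathcal{U}$ with $|\mathcal{U}_0|\le\kappa$ and $\bigcup\{\overline{U}:U\in\mathcal{U}_0\}=X$. *)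

theory Defs
  imports "HOL-Analysis.Analysis"
begin

(* Set_Algebras uses the same infix as the isomorphism of cardinals. *)
no_notation elt_set_eq (infix "=o" 50)
unbundle cardinal_syntax

definition Urysohn_space :: "'a topology \<Rightarrow> bool" where
  "Urysohn_space X \<longleftrightarrow>
     (\<forall>x\<in>topspace X. \<forall>y\<in>topspace X. x \<noteq> y \<longrightarrow>
        (\<exists>C D. closedin X C \<and> closedin X D \<and>
               x \<in> X interior_of C \<and> y \<in> X interior_of D \<and> disjnt C D))"

text \<open>Cardinals are well-order relations as in \<^theory>\<open>HOL.BNF_Cardinal_Arithmetic\<close>; a family
  indexed by \<open>\<eta> < \<kappa>\<close> is a family indexed by the field of \<open>\<kappa>\<close>.\<close>

definition regular_G_diagonal :: "'a topology \<Rightarrow> 'k rel \<Rightarrow> bool" where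
  "regular_G_diagonal X \<kappa> \<longleftrightarrow>
     (\<exists>U. (\<forall>\<eta>\<in>Field \<kappa>. openin (prod_topology X X) (U \<eta>)) \<and>
          {(x, x) | x. x \<in> topspace X} = (\<Inter>\<eta>\<in>Field \<kappa>. U \<eta>) \<and>
          {(x, x) | x. x \<in> topspace X} = (\<Inter>\<eta>\<in>Field \<kappa>. prod_topology X X closure_of (U \<eta>)))"

definition almost_Lindelof :: "'a topology \<Rightarrow> 'k rel \<Rightarrow> bool" where
  "almost_Lindelof X \<kappa> \<longleftrightarrow>
     (\<forall>\<U>. (\<forall>U\<in>\<U>. openin X U) \<and> \<Union>\<U> = topspace X \<longrightarrow>
        (\<exists>\<U>\<^sub>0. \<U>\<^sub>0 \<subseteq> \<U> \<and> |\<U>\<^sub>0| \<le>o \<kappa> \<and> (\<Union>U\<in>\<U>\<^sub>0. X closure_of U) = topspace X))"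

text \<open>Cardinals are determined only up to \<open>=o\<close>, so the least one is chosen by
  \<open>SOME\<close>.\<close>

definition least_infinite_cardinal :: "('k rel \<Rightarrow> bool) \<Rightarrow> 'k rel" where
  "least_infinite_cardinal P =
     (SOME \<kappa>. Cinfinite \<kappa> \<and> P \<kappa> \<and> (\<forall>\<kappa>'. Cinfinite \<kappa>' \<and> P \<kappa>' \<longrightarrow> \<kappa> \<le>o \<kappa>'))"

text \<open>For Urysohn \<open>X\<close> both invariants are at most \<open>|X| + \<omega>\<close>, so each is represented by a relation on \<open>'a + nat\<close>.
  The lemmas \<open>almost_Lindelof_number\<close> and \<open>regular_diagonal_degree\<close> below show that the property
  is attained and that the chosen cardinal is least among the infinite cardinals on every type.\<close>

definition almost_Lindelof_number :: "'a topology \<Rightarrow> ('a + nat) rel" where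
  "almost_Lindelof_number X = least_infinite_cardinal (almost_Lindelof X)"

definition regular_diagonal_degree :: "'a topology \<Rightarrow> ('a + nat) rel" where
  "regular_diagonal_degree X = least_infinite_cardinal (regular_G_diagonal X)"

lemma least_infinite_cardinal:
  fixes \<kappa> :: "'k rel"
  assumes "Cinfinite \<kappa>" "P \<kappa>"
  shows "Cinfinite (least_infinite_cardinal P)"
    and "P (least_infinite_cardinal P)"
    and "\<And>\<kappa>'. Cinfinite \<kappa>' \<Longrightarrow> P \<kappa>' \<Longrightarrow> least_infinite_cardinal P \<le>o \<kappa>'"
proof -
  let ?R = "{\<kappa>. Cinfinite \<kappa> \<and> P \<kappa>}"
  have "?R \<noteq> {}" "\<forall>r\<in>?R. Card_order r"
    using assms by auto
  from exists_minim_Card_order[OF this]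
  have "\<exists>\<kappa>. Cinfinite \<kappa> \<and> P \<kappa> \<and> (\<forall>\<kappa>'. Cinfinite \<kappa>' \<and> P \<kappa>' \<longrightarrow> \<kappa> \<le>o \<kappa>')"
    by (simp only: Bex_def Ball_def mem_Collect_eq conj_assoc)
  note L = someI_ex[OF this, folded least_infinite_cardinal_def]
  show "Cinfinite (least_infinite_cardinal P)" "P (least_infinite_cardinal P)"
    using L by simp_all
  show "\<And>\<kappa>'. Cinfinite \<kappa>' \<Longrightarrow> P \<kappa>' \<Longrightarrow> least_infinite_cardinal P \<le>o \<kappa>'"
    using L by simp
qed

lemma Cinfinite_transport:
  fixes \<kappa> :: "'k rel" and c :: "'c rel"
  assumes "Cinfinite \<kappa>" "\<kappa> \<le>o c"
  obtains \<kappa>' :: "'c rel" where "Cinfinite \<kappa>'" "\<kappa> =o \<kappa>'"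
proof -
  obtain f :: "'k \<Rightarrow> 'c" where f: "inj_on f (Field \<kappa>)"
    using card_of_mono2[OF assms(2)] card_of_ordLeq[of "Field \<kappa>" "Field c"] by auto
  have "|Field \<kappa>| =o |f ` Field \<kappa>|"
    using inj_on_imp_bij_betw[OF f] card_of_ordIso by auto
  then have "\<kappa> =o |f ` Field \<kappa>|"
    using assms(1) ordIso_transitive[OF ordIso_symmetric[OF card_of_Field_ordIso]] by auto
  then show thesis
    using that Cinfinite_cong[OF _ assms(1)] by blast
qed

lemma almost_Lindelof_mono:
  assumes "almost_Lindelof X \<kappa>" "\<kappa> \<le>o \<kappa>'"
  shows "almost_Lindelof X \<kappa>'"
  unfolding almost_Lindelof_def
proof (intro allI impI)
  fix \<U> assume "(\<forall>U\<in>\<U>. openin X U) \<and> \<Union>\<U> = topspace X"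
  from assms(1)[unfolded almost_Lindelof_def, rule_format, OF this]
  obtain \<U>\<^sub>0 where U: "\<U>\<^sub>0 \<subseteq> \<U>" "|\<U>\<^sub>0| \<le>o \<kappa>" "(\<Union>U\<in>\<U>\<^sub>0. X closure_of U) = topspace X"
    by (elim exE conjE)
  show "\<exists>\<U>\<^sub>0. \<U>\<^sub>0 \<subseteq> \<U> \<and> |\<U>\<^sub>0| \<le>o \<kappa>' \<and> (\<Union>U\<in>\<U>\<^sub>0. X closure_of U) = topspace X"
    by (intro exI conjI) (rule U ordLeq_transitive[OF U(2) assms(2)])+
qed

lemma regular_G_diagonal_cong:
  assumes "regular_G_diagonal X \<kappa>" "\<kappa> =o \<kappa>'"
  shows "regular_G_diagonal X \<kappa>'"
proof -
  have "|Field \<kappa>'| =o |Field \<kappa>|"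
    using ordIso_symmetric[OF card_of_cong[OF assms(2)]] .
  then obtain g where g: "g ` Field \<kappa>' = Field \<kappa>"
    using card_of_ordIso[of "Field \<kappa>'" "Field \<kappa>"] by (auto simp: bij_betw_def)
  from assms(1) obtain U where U: "\<forall>\<eta>\<in>Field \<kappa>. openin (prod_topology X X) (U \<eta>)"
    "{(x, x) | x. x \<in> topspace X} = (\<Inter>\<eta>\<in>Field \<kappa>. U \<eta>)"
    "{(x, x) | x. x \<in> topspace X} = (\<Inter>\<eta>\<in>Field \<kappa>. prod_topology X X closure_of (U \<eta>))"
    unfolding regular_G_diagonal_def by (elim exE conjE)
  have I: "(\<Inter>\<eta>\<in>Field \<kappa>. F (U \<eta>)) = (\<Inter>\<eta>\<in>Field \<kappa>'. F (U (g \<eta>)))"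
    for F :: "('a \<times> 'a) set \<Rightarrow> ('a \<times> 'a) set"
    by (simp add: g[symmetric] image_image)
  show ?thesis
    unfolding regular_G_diagonal_def
  proof (intro exI[of _ "\<lambda>\<eta>. U (g \<eta>)"] conjI)
    show "\<forall>\<eta>\<in>Field \<kappa>'. openin (prod_topology X X) (U (g \<eta>))"
      using U(1) g by blast
  qed (rule trans[OF U(2) I[of "\<lambda>S. S"]] trans[OF U(3) I])+
qed

lemma Cinfinite_topspace_csum_natLeq: "Cinfinite ( |topspace X| +c natLeq )"
  by (rule Cinfinite_csum[OF disjI2[OF natLeq_Cinfinite]])

lemma almost_Lindelof_topspace: "almost_Lindelof X ( |topspace X| +c natLeq )"
  unfolding almost_Lindelof_def
proof (intro allI impI)
  fix \<U> assume \<U>: "(\<forall>U\<in>\<U>. openin X U) \<and> \<Union>\<U> = topspace X"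
  then have "\<forall>x\<in>topspace X. \<exists>U. U \<in> \<U> \<and> x \<in> U"
    by (metis UnionE)
  then obtain f where f: "\<And>x. x \<in> topspace X \<Longrightarrow> f x \<in> \<U> \<and> x \<in> f x"
    by metis
  have "|f ` topspace X| \<le>o |topspace X| +c natLeq"
    by (rule ordLeq_transitive[OF card_of_image ordLeq_csum1[OF card_of_Card_order]])
  moreover have "(\<Union>U\<in>f ` topspace X. X closure_of U) = topspace X"
  proof
    show "topspace X \<subseteq> (\<Union>U\<in>f ` topspace X. X closure_of U)"
    proof
      fix x assume x: "x \<in> topspace X"
      then have "f x \<subseteq> X closure_of f x"
        using f \<U> by (meson closure_of_subset openin_subset)
      then show "x \<in> (\<Union>U\<in>f ` topspace X. X closure_of U)"
        using x f by blast
    qed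
  qed (intro UN_least closure_of_subset_topspace)
  ultimately show "\<exists>\<U>\<^sub>0. \<U>\<^sub>0 \<subseteq> \<U> \<and> |\<U>\<^sub>0| \<le>o |topspace X| +c natLeq \<and>
      (\<Union>U\<in>\<U>\<^sub>0. X closure_of U) = topspace X"
    using f by blast
qed

lemma Urysohn_separate_diagonal:
  assumes "Urysohn_space X" and p: "p \<in> topspace X \<times> topspace X"
  shows "\<exists>V. openin (prod_topology X X) V \<and> {(x, x) | x. x \<in> topspace X} \<subseteq> V \<and>
      (fst p \<noteq> snd p \<longrightarrow> p \<notin> prod_topology X X closure_of V)"
proof (cases "fst p = snd p")
  case True
  have "openin (prod_topology X X) (topspace X \<times> topspace X)"
    by (simp add: openin_prod_Times_iff)
  with True show ?thesis
    by (intro exI[of _ "topspace X \<times> topspace X"]) auto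
next
  case False
  let ?P = "prod_topology X X"
  have "fst p \<in> topspace X" "snd p \<in> topspace X"
    using p by (simp_all add: mem_Times_iff)
  with False assms(1) obtain C D where CD: "closedin X C" "closedin X D"
    "fst p \<in> X interior_of C" "snd p \<in> X interior_of D" "disjnt C D"
    unfolding Urysohn_space_def by metis
  let ?V = "topspace ?P - C \<times> D" and ?W = "(X interior_of C) \<times> (X interior_of D)"
  have "openin ?P ?V"
    using CD by (intro openin_diff openin_topspace) (simp add: closedin_prod_Times_iff)
  moreover have "{(x, x) | x. x \<in> topspace X} \<subseteq> ?V"
    using CD(5) by (auto simp: disjnt_iff)
  moreover have "p \<notin> ?P closure_of ?V"
  proof -
    have "openin ?P ?W"
      by (simp add: openin_prod_Times_iff)
    moreover have "p \<in> ?W"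
      using CD by (simp add: mem_Times_iff)
    moreover have "?W \<inter> ?V = {}"
      using interior_of_subset[of X C] interior_of_subset[of X D] by blast
    ultimately show ?thesis
      using openin_Int_closure_of_eq_empty[of ?P ?W ?V] by (metis IntI empty_iff)
  qed
  ultimately show ?thesis
    by (intro exI[of _ ?V] conjI impI)
qed

lemma regular_G_diagonal_topspace:
  assumes "Urysohn_space X"
  shows "regular_G_diagonal X ( |topspace X| +c natLeq )"
proof (cases "topspace X = {}")
  case True
  have "Field ( |topspace X| +c natLeq ) \<noteq> {}"
    using Cinfinite_topspace_csum_natLeq[of X] unfolding cinfinite_def by auto
  with True show ?thesis
    unfolding regular_G_diagonal_def by (intro exI[of _ "\<lambda>_. {}"]) auto
next
  case False
  let ?T = "topspace X" and ?c = "|topspace X| +c natLeq" and ?P = "prod_topology X X"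
  have "|?T| *c |?T| \<le>o ?c *c ?c"
    by (intro cprod_mono ordLeq_csum1 card_of_Card_order)
  also have "?c *c ?c =o ?c"
    by (rule cprod_infinite[OF Cinfinite_topspace_csum_natLeq])
  finally have "|?T \<times> ?T| \<le>o ?c"
    by (simp add: cprod_def Field_card_of)
  then have "|?T \<times> ?T| \<le>o |Field ?c|"
    using card_of_mono2 by (metis Field_card_of)
  then obtain g where g: "g ` Field ?c = ?T \<times> ?T"
    using False card_of_ordLeq2[of "?T \<times> ?T" "Field ?c"] by auto
  have "\<forall>p\<in>?T \<times> ?T. \<exists>V. openin ?P V \<and> {(x, x) | x. x \<in> ?T} \<subseteq> V \<and>
      (fst p \<noteq> snd p \<longrightarrow> p \<notin> ?P closure_of V)"
    using Urysohn_separate_diagonal[OF assms] by blast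
  from bchoice[OF this] obtain V where V: "\<forall>p\<in>?T \<times> ?T. openin ?P (V p) \<and>
      {(x, x) | x. x \<in> ?T} \<subseteq> V p \<and> (fst p \<noteq> snd p \<longrightarrow> p \<notin> ?P closure_of (V p))"
    by (elim exE)
  have sub: "V p \<subseteq> ?P closure_of (V p)" if "p \<in> ?T \<times> ?T" for p
    using bspec[OF V that] by (intro closure_of_subset openin_subset) simp
  have top: "?P closure_of (V p) \<subseteq> ?T \<times> ?T" for p
    using closure_of_subset_topspace[of ?P "V p"] by simp
  have ne: "?T \<times> ?T \<noteq> {}"
    using False by simp
  have A: "{(x, x) | x. x \<in> ?T} \<subseteq> (\<Inter>p\<in>?T \<times> ?T. V p)"
    using V by blast
  have B: "(\<Inter>p\<in>?T \<times> ?T. V p) \<subseteq> (\<Inter>p\<in>?T \<times> ?T. ?P closure_of (V p))"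
    using sub by blast
  have C: "(\<Inter>p\<in>?T \<times> ?T. ?P closure_of (V p)) \<subseteq> {(x, x) | x. x \<in> ?T}"
  proof
    fix q assume q: "q \<in> (\<Inter>p\<in>?T \<times> ?T. ?P closure_of (V p))"
    then have "q \<in> ?T \<times> ?T"
      using ne top by blast
    moreover from this have "fst q = snd q"
      using q V by blast
    ultimately show "q \<in> {(x, x) | x. x \<in> ?T}"
      by (cases q) auto
  qed
  have INT: "{(x, x) | x. x \<in> ?T} = (\<Inter>p\<in>?T \<times> ?T. V p)"
    "{(x, x) | x. x \<in> ?T} = (\<Inter>p\<in>?T \<times> ?T. ?P closure_of (V p))"
    by (intro equalityI A subset_trans[OF A B] subset_trans[OF B C] C)+
  have I: "(\<Inter>p\<in>?T \<times> ?T. F (V p)) = (\<Inter>\<eta>\<in>Field ?c. F (V (g \<eta>)))"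
    for F :: "('a \<times> 'a) set \<Rightarrow> ('a \<times> 'a) set"
    by (simp only: g[symmetric] image_image)
  show ?thesis
    unfolding regular_G_diagonal_def
  proof (intro exI[of _ "\<lambda>\<eta>. V (g \<eta>)"] conjI)
    show "\<forall>\<eta>\<in>Field ?c. openin ?P (V (g \<eta>))"
      using V g by blast
  qed (rule trans[OF INT(1) I[of "\<lambda>S. S"]] trans[OF INT(2) I])+
qed

lemma almost_Lindelof_number:
  shows "Cinfinite (almost_Lindelof_number X)"
    and "almost_Lindelof X (almost_Lindelof_number X)"
    and "\<And>\<kappa> :: 'k rel. Cinfinite \<kappa> \<Longrightarrow> almost_Lindelof X \<kappa> \<Longrightarrow> almost_Lindelof_number X \<le>o \<kappa>"
proof -
  note L = least_infinite_cardinal[where P = "almost_Lindelof X",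
      OF Cinfinite_topspace_csum_natLeq almost_Lindelof_topspace, folded almost_Lindelof_number_def]
  show "Cinfinite (almost_Lindelof_number X)" "almost_Lindelof X (almost_Lindelof_number X)"
    using L by blast+
  fix \<kappa> :: "'k rel" assume \<kappa>: "Cinfinite \<kappa>" "almost_Lindelof X \<kappa>"
  show "almost_Lindelof_number X \<le>o \<kappa>"
  proof (rule ccontr)
    assume "\<not> ?thesis"
    moreover have "Well_order \<kappa>" "Well_order (almost_Lindelof_number X)"
      using \<kappa>(1) L(1) by (simp_all add: card_order_on_well_order_on)
    ultimately have "\<kappa> \<le>o almost_Lindelof_number X"
      using ordLeq_total by auto
    then obtain \<kappa>' :: "('a + nat) rel" where \<kappa>': "Cinfinite \<kappa>'" "\<kappa> =o \<kappa>'"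
      using Cinfinite_transport[OF \<kappa>(1)] by auto
    then have "almost_Lindelof_number X \<le>o \<kappa>'"
      using L(3) almost_Lindelof_mono[OF \<kappa>(2) ordIso_imp_ordLeq] by auto
    with \<kappa>'(2) \<open>\<not> ?thesis\<close> show False
      using ordLeq_ordIso_trans[OF _ ordIso_symmetric] by auto
  qed
qed

lemma regular_diagonal_degree:
  assumes "Urysohn_space X"
  shows "Cinfinite (regular_diagonal_degree X)"
    and "regular_G_diagonal X (regular_diagonal_degree X)"
    and "\<And>\<kappa> :: 'k rel. Cinfinite \<kappa> \<Longrightarrow> regular_G_diagonal X \<kappa> \<Longrightarrow> regular_diagonal_degree X \<le>o \<kappa>"
proof -
  note L = least_infinite_cardinal[where P = "regular_G_diagonal X",
      OF Cinfinite_topspace_csum_natLeq regular_G_diagonal_topspace[OF assms],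
      folded regular_diagonal_degree_def]
  show "Cinfinite (regular_diagonal_degree X)" "regular_G_diagonal X (regular_diagonal_degree X)"
    using L by blast+
  fix \<kappa> :: "'k rel" assume \<kappa>: "Cinfinite \<kappa>" "regular_G_diagonal X \<kappa>"
  show "regular_diagonal_degree X \<le>o \<kappa>"
  proof (rule ccontr)
    assume "\<not> ?thesis"
    moreover have "Well_order \<kappa>" "Well_order (regular_diagonal_degree X)"
      using \<kappa>(1) L(1) by (simp_all add: card_order_on_well_order_on)
    ultimately have "\<kappa> \<le>o regular_diagonal_degree X"
      using ordLeq_total by auto
    then obtain \<kappa>' :: "('a + nat) rel" where \<kappa>': "Cinfinite \<kappa>'" "\<kappa> =o \<kappa>'"
      using Cinfinite_transport[OF \<kappa>(1)] by auto
    then have "regular_diagonal_degree X \<le>o \<kappa>'"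
      using L(3) regular_G_diagonal_cong[OF \<kappa>(2)] by auto
    with \<kappa>'(2) \<open>\<not> ?thesis\<close> show False
      using ordLeq_ordIso_trans[OF _ ordIso_symmetric] by auto
  qed
qed

end

theory Submission
  imports Defs
begin

text \<open>Given \<open>\<eta> < \<kappa>\<close>, cover \<open>X\<close> by the open sets \<open>V\<close> with \<open>V \<times> V \<subseteq> U\<^sub>\<eta>\<close> and choose at most \<open>aL(X)\<close>
  of them whose closures cover \<open>X\<close>. Send \<open>x\<close> to the family assigning to each \<open>\<eta>\<close> a chosen \<open>V\<close> with
  \<open>x\<close> in its closure. Points \<open>x\<close>, \<open>y\<close> with the same family satisfy
  \<open>(x, y) \<in> cl V \<times> cl V \<subseteq> cl U\<^sub>\<eta>\<close> for every \<open>\<eta>\<close>, so \<open>x = y\<close>.\<close>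

text \<open>Open sets with square inside \<open>U\<close> cover the space because \<open>U\<close>
  is a neighbourhood of the diagonal. Closure commutes with binary products, so the square of a
  closure is the closure of a square and stays in the closure of \<open>U\<close>.\<close>

lemma almost_Lindelof_closures_of_squares:
  assumes "almost_Lindelof X \<mu>" and U: "openin (prod_topology X X) U"
    and diag: "{(x, x) | x. x \<in> topspace X} \<subseteq> U"
  obtains \<W> where "|\<W>| \<le>o \<mu>" "(\<Union>V\<in>\<W>. X closure_of V) = topspace X"
    "\<forall>V\<in>\<W>. (X closure_of V) \<times> (X closure_of V) \<subseteq> prod_topology X X closure_of U"
proof -
  define \<V> where "\<V> = {V. openin X V \<and> V \<times> V \<subseteq> U}"
  have cover: "\<exists>V\<in>\<V>. x \<in> V" if "x \<in> topspace X" for x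
  proof -
    have "(x, x) \<in> U" using that by (intro subsetD[OF diag]) simp
    from U[unfolded openin_prod_topology_alt, rule_format, OF this]
    obtain A B where AB: "openin X A" "openin X B" "x \<in> A" "x \<in> B" "A \<times> B \<subseteq> U"
      by (elim exE conjE)
    \<comment> \<open>A basic box around \<open>(x, x)\<close> need not be a square; intersecting
      its sides makes it one.\<close>
    then have "A \<inter> B \<in> \<V>"
      unfolding \<V>_def by blast
    with AB show ?thesis by blast
  qed
  have "openin X V" if "V \<in> \<V>" for V
    using that unfolding \<V>_def by simp
  moreover from this have "\<Union>\<V> = topspace X"
    by (intro equalityI Union_least subsetI[of "topspace X"] openin_subset)
      (simp_all only: Union_iff cover)
  ultimately have "(\<forall>V\<in>\<V>. openin X V) \<and> \<Union>\<V> = topspace X"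
    by simp
  from assms(1)[unfolded almost_Lindelof_def, rule_format, OF this]
  obtain \<W> where \<W>: "\<W> \<subseteq> \<V>" "|\<W>| \<le>o \<mu>" "(\<Union>V\<in>\<W>. X closure_of V) = topspace X"
    by (elim exE conjE)
  show thesis
  proof (rule that[OF \<W>(2,3)], rule ballI)
    fix V assume "V \<in> \<W>"
    then have "V \<times> V \<subseteq> U"
      using \<W>(1) unfolding \<V>_def by blast
    then show "(X closure_of V) \<times> (X closure_of V) \<subseteq> prod_topology X X closure_of U"
      by (metis closure_of_Times closure_of_mono)
  qed
qed

lemma card_topspace_le_almost_Lindelof_regular_G_diagonal:
  assumes \<mu>: "almost_Lindelof X \<mu>" and "regular_G_diagonal X \<kappa>"
  shows "|topspace X| \<le>o \<mu> ^c \<kappa>"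
proof -
  let ?P = "prod_topology X X"
  obtain U where U: "\<forall>\<eta>\<in>Field \<kappa>. openin ?P (U \<eta>)"
    and diag: "{(x, x) | x. x \<in> topspace X} = (\<Inter>\<eta>\<in>Field \<kappa>. U \<eta>)"
    and diag_cl: "{(x, x) | x. x \<in> topspace X} = (\<Inter>\<eta>\<in>Field \<kappa>. ?P closure_of U \<eta>)"
    using assms(2) unfolding regular_G_diagonal_def by (elim exE conjE)
  have "\<forall>\<eta>\<in>Field \<kappa>. \<exists>\<W>. |\<W>| \<le>o \<mu> \<and> (\<Union>V\<in>\<W>. X closure_of V) = topspace X \<and>
      (\<forall>V\<in>\<W>. (X closure_of V) \<times> (X closure_of V) \<subseteq> ?P closure_of U \<eta>)"
  proof
    fix \<eta> assume \<eta>: "\<eta> \<in> Field \<kappa>"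
    have sub: "{(x, x) | x. x \<in> topspace X} \<subseteq> U \<eta>"
      unfolding diag using \<eta> by (rule INT_lower)
    obtain \<W> where "|\<W>| \<le>o \<mu>" "(\<Union>V\<in>\<W>. X closure_of V) = topspace X"
      "\<forall>V\<in>\<W>. (X closure_of V) \<times> (X closure_of V) \<subseteq> ?P closure_of U \<eta>"
      by (rule almost_Lindelof_closures_of_squares[OF \<mu> bspec[OF U \<eta>] sub]) (rule that)
    then show "\<exists>\<W>. |\<W>| \<le>o \<mu> \<and> (\<Union>V\<in>\<W>. X closure_of V) = topspace X \<and>
      (\<forall>V\<in>\<W>. (X closure_of V) \<times> (X closure_of V) \<subseteq> ?P closure_of U \<eta>)"
      by (intro exI conjI)
  qed
  from bchoice[OF this] obtain \<W> where \<W>: "\<forall>\<eta>\<in>Field \<kappa>. |\<W> \<eta>| \<le>o \<mu> \<and>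
      (\<Union>V\<in>\<W> \<eta>. X closure_of V) = topspace X \<and>
      (\<forall>V\<in>\<W> \<eta>. (X closure_of V) \<times> (X closure_of V) \<subseteq> ?P closure_of U \<eta>)"
    by (elim exE)
  have small: "|\<W> \<eta>| \<le>o \<mu>"
    and cover: "(\<Union>V\<in>\<W> \<eta>. X closure_of V) = topspace X"
    and square: "\<forall>V\<in>\<W> \<eta>. (X closure_of V) \<times> (X closure_of V) \<subseteq> ?P closure_of U \<eta>"
    if "\<eta> \<in> Field \<kappa>" for \<eta>
    by (intro conjunct1[OF \<W>[THEN bspec, OF that]]
        \<W>[THEN bspec, OF that, THEN conjunct2, THEN conjunct1]
        \<W>[THEN bspec, OF that, THEN conjunct2, THEN conjunct2])+
  \<comment> \<open>The families \<open>\<W> \<eta>\<close> vary with \<open>\<eta>\<close>; coding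
    each injectively in \<open>Field \<mu>\<close> gives all choice functions one common
    codomain.\<close>
  have "\<exists>h. inj_on h (\<W> \<eta>) \<and> h ` \<W> \<eta> \<subseteq> Field \<mu>" if "\<eta> \<in> Field \<kappa>" for \<eta>
    using card_of_mono2[OF small[OF that]] by (simp add: card_of_ordLeq Field_card_of)
  then obtain h where inj: "\<And>\<eta>. \<eta> \<in> Field \<kappa> \<Longrightarrow> inj_on (h \<eta>) (\<W> \<eta>)"
    and range: "\<And>\<eta>. \<eta> \<in> Field \<kappa> \<Longrightarrow> h \<eta> ` \<W> \<eta> \<subseteq> Field \<mu>"
    by metis
  have "\<exists>V. V \<in> \<W> \<eta> \<and> x \<in> X closure_of V" if "x \<in> topspace X" "\<eta> \<in> Field \<kappa>" for x \<eta>
    using cover[OF that(2)] that(1) by blast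
  then obtain v where v: "\<And>x \<eta>. x \<in> topspace X \<Longrightarrow> \<eta> \<in> Field \<kappa> \<Longrightarrow>
      v x \<eta> \<in> \<W> \<eta> \<and> x \<in> X closure_of (v x \<eta>)"
    by metis
  \<comment> \<open>\<open>Func\<close> requires the value \<open>undefined\<close> outside the
    domain, and \<open>\<mu> ^c \<kappa>\<close> is by definition the cardinality of
    \<open>Func (Field \<kappa>) (Field \<mu>)\<close>.\<close>
  define f where "f x = (\<lambda>\<eta>. if \<eta> \<in> Field \<kappa> then h \<eta> (v x \<eta>) else undefined)" for x
  have "inj_on f (topspace X)"
  proof (rule inj_onI)
    fix x y assume xy: "x \<in> topspace X" "y \<in> topspace X" and eq: "f x = f y"
    have "(x, y) \<in> ?P closure_of U \<eta>" if \<eta>: "\<eta> \<in> Field \<kappa>" for \<eta>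
    proof -
      have "h \<eta> (v x \<eta>) = h \<eta> (v y \<eta>)"
        using fun_cong[OF eq, of \<eta>] \<eta> by (simp add: f_def)
      \<comment> \<open>Equal codes under the same \<open>h \<eta>\<close> mean the same chosen set,
        whose closure then contains both points.\<close>
      then have "v x \<eta> = v y \<eta>"
        using inj[OF \<eta>] v[OF _ \<eta>] xy by (simp add: inj_on_eq_iff)
      then show ?thesis
        using bspec[OF square[OF \<eta>], of "v x \<eta>"] v[OF xy(1) \<eta>] v[OF xy(2) \<eta>] by auto
    qed
    then have "(x, y) \<in> {(x, x) | x. x \<in> topspace X}"
      unfolding diag_cl by (rule INT_I)
    then show "x = y" by blast
  qed
  moreover have "f ` topspace X \<subseteq> Func (Field \<kappa>) (Field \<mu>)"
    using v range by (fastforce simp: Func_def f_def)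
  ultimately show ?thesis
    unfolding cexp_def using card_of_ordLeq by blast
qed

text \<open>Both invariants attain their defining property, so they can serve as
  \<open>\<mu>\<close> and \<open>\<kappa>\<close>; for the diagonal degree this attainment comes
  from the Urysohn hypothesis.\<close>

theorem theorem4p16:
  fixes X :: "'a topology"
  assumes "Urysohn_space X"
  shows "|topspace X| \<le>o almost_Lindelof_number X ^c regular_diagonal_degree X"
  by (rule card_topspace_le_almost_Lindelof_regular_G_diagonal
      [OF almost_Lindelof_number(2) regular_diagonal_degree(2)[OF assms]])

end
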